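(* Let $\mathcal A$ and $\mathcal B$ be ideals of closed subsets of a space $X$. If $X$ is $\mathcal A$-normal and $\mathcal B$ consists of sequentially compact sets, then $$\mathsf G_1(\mathscr{N}_X[\mathcal A], \neg \Lambda_X(\mathcal B)) \leq_{\mathrm{II}} \mathsf G_1(\mathscr{T}_{\mathrm{MC}_{\mathcal A}(X)}, \mathrm{CD}_{\mathrm{MC}_{\mathcal B}(X)}).$$ Consequently, $$\mathsf G_1(\mathscr N_X[\mathcal A], \neg \mathcal O_X(\mathcal B)) \equiv \mathsf G_1(\mathscr N_{\mathrm{MC}_{\mathcal A}(X),\mathbf 0}, \neg \Omega_{\mathrm{MC}_{\mathcal B}(X),\mathbf 0}) \equiv \mathsf G_1(\mathscr T_{\mathrm{MC}_{\mathcal A}(X)}, \neg \Omega_{\mathrm{MC}_{\mathcal B}(X),\mathbf 0}) \equiv \mathsf G_1(\mathscr{T}_{\mathrm{MC}_{\mathcal A}(X)}, \mathrm{CD}_{\mathrm{MC}_{\mathcal B}(X)}).$$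
   Context: Spaces and ideals. All spaces are Hausdorff. An ideal of closed sets of $X$ is a family $\mathcal A$ of non-empty closed subsets of $X$ such that $A\cup B\in\mathcal A$ for $A,B\in\mathcal A$; every non-empty closed subset of a member of $\mathcal A$ is in $\mathcal A$; and $\{x\}\in\mathcal A$ for every $x\in X$. Every ideal of closed sets is assumed not to contain $X$ itself. $X$ is $\mathcal A$-normal if for all $A\in\mathcal A$ and open $U\supseteq A$ there is an open $V$ with $A\subseteq V\subseteq \mathrm{cl}(V)\subseteq U$. Minimal cusco maps. A cusco map $\Phi$ from $X$ to $\mathbb R$ assigns to each $x\in X$ a non-empty compact convex set $\Phi(x)\subseteq\mathbb R$ and is upper semicontinuous: $\{x\in X:\Phi(x)\subseteq V\}$ is open for every open $V\subseteq\mathbb R$. It is minimal if its graph $\{\langle x,y\rangle:y\in\Phi(x)\}$ is $\subseteq$-minimal among graphs of cusco maps from $X$ to $\mathbb R$. $\mathrm{MC}(X)$ is the set of all minimal cusco maps from $X$ to $\mathbb R$; $\mathbf 0\in \mathrm{MC}(X)$ is the map constantly $\{0\}$. For $A\subseteq X$ and $\varepsilon>0$, $\mathbf W(A,\varepsilon)$ is the set of pairs $\langle\Phi,\Psi\rangle$ such that for all $x\in A$, $\Phi(x)\subseteq\bigcup_{y\in\Psi(x)}B(y,\varepsilon)$ and $\Psi(x)\subseteq\bigcup_{y\in\Phi(x)}B(y,\varepsilon)$, where $B(y,\varepsilon)=(y-\varepsilon,y+\varepsilon)$. $\mathrm{MC}_{\mathcal A}(X)$ is $\mathrm{MC}(X)$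 with the topology generated by the uniformity with base $\{\mathbf W(A,\varepsilon):A\in\mathcal A,\varepsilon>0\}$. Collections. An $\mathcal A$-cover of $X$ is an open cover $\mathscr U$ of $X$ with $\emptyset\notin\mathscr U$, $X\notin\mathscr U$ such that every $A\in\mathcal A$ is contained in some $U\in\mathscr U$. $\mathcal O_X(\mathcal A)$ is the set of all $\mathcal A$-covers. $\Lambda_X(\mathcal A)$ is the set of all $\mathcal A$-covers $\mathscr U$ such that $\{U\in\mathscr U:A\subseteq U\}$ is infinite for every $A\in\mathcal A$. For a space $Y$ and $y\in Y$: $\mathscr T_Y$ is the set of all proper non-empty open subsets of $Y$; $\mathscr N_{Y,y}=\{U\in\mathscr T_Y:y\in U\}$; $\mathscr N_Y(A)=\{U\in\mathscr T_Y:A\subseteq U\}$ for $A\subseteq Y$, and $\mathscr N_Y[\mathcal A]=\{\mathscr N_Y(A):A\in\mathcal A\}$; $\Omega_{Y,y}=\{A\subseteq Y:y\in\mathrm{cl}_Y(A)\}$; $\mathrm{CD}_Y$ is the set of closed and discrete subsets of $Y$. $\neg\mathcal D$ is the collection of sets not in $\mathcal D$. Games. In $\mathsf G_1(\mathcal C,\mathcal D)$, in inning $n\in\omega$ One plays $A_n\in\mathcal C$ and Two responds with $x_n\in A_n$; Two wins if $\{x_n:n\in\omega\}\in\mathcal D$, otherwise One wins. $\mathrm I\uparrow\mathcal G$ (resp. $\mathrm{II}\uparrow\mathcal G$): One (resp. Two) has a winning strategy, where strategies may depend on all previous moves of the opponent (for Two, including the current one). $\mathrm I\uparrow_{\mathrm{pre}}\mathcal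 G$: One has a winning predetermined strategy, i.e. one depending only on $n$. $\mathrm{II}\uparrow_{\mathrm{mark}}\mathcal G$: Two has a winning Markov strategy, i.e. one depending only on One's current move and $n$. A slashed arrow denotes negation. $\mathcal G\leq_{\mathrm{II}}\mathcal H$ means that all four implications hold: $\mathrm{II}\uparrow_{\mathrm{mark}}\mathcal G\Rightarrow\mathrm{II}\uparrow_{\mathrm{mark}}\mathcal H$; $\mathrm{II}\uparrow\mathcal G\Rightarrow\mathrm{II}\uparrow\mathcal H$; $\mathrm I\not\uparrow\mathcal G\Rightarrow\mathrm I\not\uparrow\mathcal H$; $\mathrm I\not\uparrow_{\mathrm{pre}}\mathcal G\Rightarrow\mathrm I\not\uparrow_{\mathrm{pre}}\mathcal H$. $\mathcal G\equiv\mathcal H$ (equivalent) means $\mathcal G\leq_{\mathrm{II}}\mathcal H$ and $\mathcal H\leq_{\mathrm{II}}\mathcal G$. *)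

theory Defs
  imports "HOL-Analysis.Analysis"
begin

text \<open>The Hausdorff space X is the universe of a type of class \<open>t2_space\<close>; as an abstract topology
  it is \<open>euclidean\<close>, which for any topological type is the topology given by \<open>open\<close>.\<close>

definition closed_ideal :: "'a::topological_space set set \<Rightarrow> bool" where
  "closed_ideal \<A> \<longleftrightarrow>
     (\<forall>A\<in>\<A>. A \<noteq> {} \<and> closed A) \<and>
     (\<forall>A\<in>\<A>. \<forall>B\<in>\<A>. A \<union> B \<in> \<A>) \<and>
     (\<forall>A\<in>\<A>. \<forall>B. B \<noteq> {} \<and> closed B \<and> B \<subseteq> A \<longrightarrow> B \<in> \<A>) \<and>
     (\<forall>x. {x} \<in> \<A>) \<and>
     UNIV \<notin> \<A>"

definition ideal_normal :: "'a::topological_space set set \<Rightarrow> bool" where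
  "ideal_normal \<A> \<longleftrightarrow>
     (\<forall>A\<in>\<A>. \<forall>U. open U \<and> A \<subseteq> U \<longrightarrow> (\<exists>V. open V \<and> A \<subseteq> V \<and> closure V \<subseteq> U))"

definition ideal_covers :: "'a::topological_space set set \<Rightarrow> 'a set set set" where
  "ideal_covers \<A> =
     {\<U>. (\<forall>U\<in>\<U>. open U) \<and> \<Union>\<U> = UNIV \<and> {} \<notin> \<U> \<and> UNIV \<notin> \<U> \<and>
          (\<forall>A\<in>\<A>. \<exists>U\<in>\<U>. A \<subseteq> U)}"

definition large_ideal_covers :: "'a::topological_space set set \<Rightarrow> 'a set set set" where
  "large_ideal_covers \<A> = {\<U> \<in> ideal_covers \<A>. \<forall>A\<in>\<A>. infinite {U\<in>\<U>. A \<subseteq> U}}"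


definition proper_opens :: "'b topology \<Rightarrow> 'b set set" where
  "proper_opens Y = {U. openin Y U \<and> U \<noteq> {} \<and> U \<noteq> topspace Y}"

definition point_nbhds :: "'b topology \<Rightarrow> 'b \<Rightarrow> 'b set set" where
  "point_nbhds Y y = {U \<in> proper_opens Y. y \<in> U}"

definition set_nbhds :: "'b topology \<Rightarrow> 'b set \<Rightarrow> 'b set set" where
  "set_nbhds Y A = {U \<in> proper_opens Y. A \<subseteq> U}"

definition clustering_sets :: "'b topology \<Rightarrow> 'b \<Rightarrow> 'b set set" where
  "clustering_sets Y y = {A. A \<subseteq> topspace Y \<and> y \<in> Y closure_of A}"

definition closed_discrete_sets :: "'b topology \<Rightarrow> 'b set set" where
  "closed_discrete_sets Y = {D. closedin Y D \<and> subtopology Y D = discrete_topology D}"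


definition cusco :: "('a::topological_space \<Rightarrow> real set) \<Rightarrow> bool" where
  "cusco \<Phi> \<longleftrightarrow>
     (\<forall>x. \<Phi> x \<noteq> {} \<and> compact (\<Phi> x) \<and> convex (\<Phi> x)) \<and>
     (\<forall>V. open V \<longrightarrow> open {x. \<Phi> x \<subseteq> V})"

definition set_graph :: "('a \<Rightarrow> 'b set) \<Rightarrow> ('a \<times> 'b) set" where
  "set_graph \<Phi> = {(x, y). y \<in> \<Phi> x}"

definition MC :: "('a::topological_space \<Rightarrow> real set) set" where
  "MC = {\<Phi>. cusco \<Phi> \<and>
            (\<forall>\<Psi>. cusco \<Psi> \<and> set_graph \<Psi> \<subseteq> set_graph \<Phi> \<longrightarrow> set_graph \<Psi> = set_graph \<Phi>)}"

definition MC_entourage ::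
  "'a::topological_space set \<Rightarrow> real \<Rightarrow> (('a \<Rightarrow> real set) \<times> ('a \<Rightarrow> real set)) set" where
  "MC_entourage A \<epsilon> =
     {(\<Phi>, \<Psi>). \<Phi> \<in> MC \<and> \<Psi> \<in> MC \<and>
        (\<forall>x\<in>A. \<Phi> x \<subseteq> (\<Union>y\<in>\<Psi> x. ball y \<epsilon>) \<and> \<Psi> x \<subseteq> (\<Union>y\<in>\<Phi> x. ball y \<epsilon>))}"

definition MC_uniformity ::
  "'a::topological_space set set \<Rightarrow> (('a \<Rightarrow> real set) \<times> ('a \<Rightarrow> real set)) set set" where
  "MC_uniformity \<A> = {E. E \<subseteq> MC \<times> MC \<and> (\<exists>A\<in>\<A>. \<exists>\<epsilon>>0. MC_entourage A \<epsilon> \<subseteq> E)}"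

text \<open>The predicate below is a topology on \<open>MC\<close> only because \<open>\<A>\<close> is directed and non-empty; see
  \<open>openin_MC_space\<close> and \<open>topspace_MC_space\<close>.\<close>

definition MC_space :: "'a::topological_space set set \<Rightarrow> ('a \<Rightarrow> real set) topology" where
  "MC_space \<A> = topology (\<lambda>G. G \<subseteq> MC \<and> (\<forall>\<Phi>\<in>G. \<exists>E\<in>MC_uniformity \<A>. E `` {\<Phi>} \<subseteq> G))"

lemma MC_uniformity_Int:
  assumes "closed_ideal \<A>" "E \<in> MC_uniformity \<A>" "F \<in> MC_uniformity \<A>"
  shows "E \<inter> F \<in> MC_uniformity \<A>"
proof -
  obtain A a B b where *: "A \<in> \<A>" "a > 0" "MC_entourage A a \<subseteq> E"
      "B \<in> \<A>" "b > 0" "MC_entourage B b \<subseteq> F" "E \<subseteq> MC \<times> MC"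
    using assms(2,3) unfolding MC_uniformity_def mem_Collect_eq by metis
  have mono: "MC_entourage (A \<union> B) (min a b) \<subseteq> MC_entourage C c"
    if "C \<subseteq> A \<union> B" "min a b \<le> c" for C c
  proof -
    have ball_mono: "(\<Union>y\<in>S. ball y (min a b)) \<subseteq> (\<Union>y\<in>S. ball y c)" for S :: "real set"
      using subset_ball[OF that(2)] by blast
    show ?thesis
    proof (rule subsetI)
      fix p assume p: "p \<in> MC_entourage (A \<union> B) (min a b)"
      obtain \<Phi> \<Psi> where "p = (\<Phi>, \<Psi>)" by (cases p)
      have "\<Phi> x \<subseteq> (\<Union>y\<in>\<Psi> x. ball y c) \<and> \<Psi> x \<subseteq> (\<Union>y\<in>\<Phi> x. ball y c)" if "x \<in> C" for x
      proof -
        have "x \<in> A \<union> B" using that \<open>C \<subseteq> A \<union> B\<close> by (rule rev_subsetD)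
        with p have "\<Phi> x \<subseteq> (\<Union>y\<in>\<Psi> x. ball y (min a b))" "\<Psi> x \<subseteq> (\<Union>y\<in>\<Phi> x. ball y (min a b))"
          unfolding MC_entourage_def mem_Collect_eq \<open>p = _\<close> prod.case by metis+
        with ball_mono show ?thesis by (meson subset_trans)
      qed
      with p show "p \<in> MC_entourage C c"
        unfolding MC_entourage_def mem_Collect_eq \<open>p = _\<close> prod.case by metis
    qed
  qed
  have "A \<union> B \<in> \<A>"
    using assms(1) *(1,4) unfolding closed_ideal_def by metis
  moreover have "min a b > 0"
    using *(2,5) by simp
  moreover have "MC_entourage (A \<union> B) (min a b) \<subseteq> E \<inter> F"
    using mono[of A a, THEN subset_trans, OF _ _ *(3)] mono[of B b, THEN subset_trans, OF _ _ *(6)]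
    by simp
  moreover have "E \<inter> F \<subseteq> MC \<times> MC"
    using *(7) by (rule le_infI1)
  ultimately show ?thesis
    unfolding MC_uniformity_def mem_Collect_eq by metis
qed

lemma openin_MC_space:
  assumes "closed_ideal \<A>"
  shows "openin (MC_space \<A>) G \<longleftrightarrow>
           G \<subseteq> MC \<and> (\<forall>\<Phi>\<in>G. \<exists>E\<in>MC_uniformity \<A>. E `` {\<Phi>} \<subseteq> G)"
proof -
  let ?P = "\<lambda>G. G \<subseteq> MC \<and> (\<forall>\<Phi>\<in>G. \<exists>E\<in>MC_uniformity \<A>. E `` {\<Phi>} \<subseteq> G)"
  have step1: "?P (S \<inter> T)" if S: "?P S" and T: "?P T" for S T
  proof (intro conjI ballI)
    show "S \<inter> T \<subseteq> MC"
      using S by (rule le_infI1[OF conjunct1])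
  next
    fix \<Phi> assume \<Phi>: "\<Phi> \<in> S \<inter> T"
    obtain E where E: "E \<in> MC_uniformity \<A>" "E `` {\<Phi>} \<subseteq> S"
      using bspec[OF conjunct2[OF S] IntD1[OF \<Phi>]] by (rule bexE)
    obtain F where F: "F \<in> MC_uniformity \<A>" "F `` {\<Phi>} \<subseteq> T"
      using bspec[OF conjunct2[OF T] IntD2[OF \<Phi>]] by (rule bexE)
    have "(E \<inter> F) `` {\<Phi>} \<subseteq> S \<inter> T"
      using E(2) F(2) by auto
    then show "\<exists>E\<in>MC_uniformity \<A>. E `` {\<Phi>} \<subseteq> S \<inter> T"
      using MC_uniformity_Int[OF assms E(1) F(1)] by (rule bexI)
  qed
  have step2: "?P (\<Union>\<K>)" if \<K>: "\<forall>K\<in>\<K>. ?P K" for \<K>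
  proof (intro conjI ballI)
    show "\<Union>\<K> \<subseteq> MC"
      by (rule Sup_least) (rule conjunct1[OF bspec[OF \<K>]])
  next
    fix \<Phi> assume "\<Phi> \<in> \<Union>\<K>"
    then obtain K where K: "K \<in> \<K>" "\<Phi> \<in> K" by (rule UnionE)
    obtain E where E: "E \<in> MC_uniformity \<A>" "E `` {\<Phi>} \<subseteq> K"
      using bspec[OF conjunct2[OF bspec[OF \<K> K(1)]] K(2)] by (rule bexE)
    have "E `` {\<Phi>} \<subseteq> \<Union>\<K>"
      using E(2) Union_upper[OF K(1)] by (rule subset_trans)
    then show "\<exists>E\<in>MC_uniformity \<A>. E `` {\<Phi>} \<subseteq> \<Union>\<K>"
      using E(1) by (rule bexI)
  qed
  have "istopology ?P"
    unfolding istopology_def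
  proof (rule conjI)
    show "\<forall>S T. ?P S \<longrightarrow> ?P T \<longrightarrow> ?P (S \<inter> T)"
      using step1 by (rule allI[OF allI[OF impI[OF impI]]])
    show "\<forall>\<K>. (\<forall>K\<in>\<K>. ?P K) \<longrightarrow> ?P (\<Union>\<K>)"
      using step2 by (rule allI[OF impI])
  qed
  then show ?thesis
    unfolding MC_space_def by (simp add: topology_inverse')
qed

lemma topspace_MC_space:
  fixes \<A> :: "'a::topological_space set set"
  assumes "closed_ideal \<A>"
  shows "topspace (MC_space \<A>) = MC"
proof -
  have "{undefined} \<in> \<A>"
    using assms unfolding closed_ideal_def by metis
  moreover have "MC_entourage {undefined} 1 \<subseteq> MC \<times> MC"
    by (auto simp: MC_entourage_def)
  ultimately have "MC \<times> MC \<in> MC_uniformity \<A>"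
    unfolding MC_uniformity_def mem_Collect_eq by (metis order_refl zero_less_one)
  moreover have "(MC \<times> MC) `` {\<Phi>} \<subseteq> MC" for \<Phi> :: "'a \<Rightarrow> real set"
    by auto
  ultimately have "openin (MC_space \<A>) MC"
    unfolding openin_MC_space[OF assms] by (metis order_refl)
  moreover have "topspace (MC_space \<A>) \<subseteq> MC"
    using openin_topspace[of "MC_space \<A>"] unfolding openin_MC_space[OF assms] by (rule conjunct1)
  ultimately show ?thesis
    using openin_subset by (metis subset_antisym)
qed


text \<open>\<open>G1 \<C> \<D>\<close>: One's moves are the members of \<open>\<C>\<close>, and Two wins a play if the set of her
  responses belongs to \<open>\<D>\<close>.\<close>

datatype 'a selection_game = G1 (moves: "'a set set") (target: "'a set set")

text \<open>A strategy for One maps the list of Two's earlier responses to a move; a strategy for Two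
  maps the non-empty list of One's moves so far, the current one last, to a response. Demanding legal moves of One on
  unreachable histories as well is no restriction.\<close>

definition One_wins :: "'a selection_game \<Rightarrow> bool" where
  "One_wins G \<longleftrightarrow>
     (\<exists>\<sigma> :: 'a list \<Rightarrow> 'a set.
        (\<forall>h. \<sigma> h \<in> moves G) \<and>
        (\<forall>x :: nat \<Rightarrow> 'a. (\<forall>n. x n \<in> \<sigma> (map x [0..<n])) \<longrightarrow> range x \<notin> target G))"

definition One_wins_pre :: "'a selection_game \<Rightarrow> bool" where
  "One_wins_pre G \<longleftrightarrow>
     (\<exists>\<sigma> :: nat \<Rightarrow> 'a set.
        (\<forall>n. \<sigma> n \<in> moves G) \<and>
        (\<forall>x :: nat \<Rightarrow> 'a. (\<forall>n. x n \<in> \<sigma> n) \<longrightarrow> range x \<notin> target G))"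

definition Two_wins :: "'a selection_game \<Rightarrow> bool" where
  "Two_wins G \<longleftrightarrow>
     (\<exists>\<tau> :: 'a set list \<Rightarrow> 'a.
        \<forall>A :: nat \<Rightarrow> 'a set. (\<forall>n. A n \<in> moves G) \<longrightarrow>
          (\<forall>n. \<tau> (map A [0..<Suc n]) \<in> A n) \<and>
          range (\<lambda>n. \<tau> (map A [0..<Suc n])) \<in> target G)"

definition Two_wins_mark :: "'a selection_game \<Rightarrow> bool" where
  "Two_wins_mark G \<longleftrightarrow>
     (\<exists>\<tau> :: 'a set \<Rightarrow> nat \<Rightarrow> 'a.
        \<forall>A :: nat \<Rightarrow> 'a set. (\<forall>n. A n \<in> moves G) \<longrightarrow>
          (\<forall>n. \<tau> (A n) n \<in> A n) \<and>
          range (\<lambda>n. \<tau> (A n) n) \<in> target G)"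

definition game_le :: "'a selection_game \<Rightarrow> 'b selection_game \<Rightarrow> bool"
    (infix "\<le>\<^sub>I\<^sub>I" 50) where
  "G \<le>\<^sub>I\<^sub>I H \<longleftrightarrow>
     (Two_wins_mark G \<longrightarrow> Two_wins_mark H) \<and>
     (Two_wins G \<longrightarrow> Two_wins H) \<and>
     (\<not> One_wins G \<longrightarrow> \<not> One_wins H) \<and>
     (\<not> One_wins_pre G \<longrightarrow> \<not> One_wins_pre H)"

definition game_equiv :: "'a selection_game \<Rightarrow> 'b selection_game \<Rightarrow> bool"
    (infix "\<equiv>\<^sub>I\<^sub>I" 50) where
  "G \<equiv>\<^sub>I\<^sub>I H \<longleftrightarrow> G \<le>\<^sub>I\<^sub>I H \<and> H \<le>\<^sub>I\<^sub>I G"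

end

theory Submission
  imports Defs
begin

text \<open>
  All five games are linked by one cycle of translations. A translation turns each move of One in
  the second game into a move in the first, and turns Two's reply there back into a reply in the
  second, in such a way that Two's wins are carried along; it yields all four clauses of
  \<open>\<le>\<^sub>I\<^sub>I\<close> at once (\<open>game_le_by_translation\<close>). Write \<open>O\<close> for the set of
  \<open>\<B>\<close>-covers. Since the whole space is never a member of a cover, a \<open>\<B>\<close>-cover is automatically
  large: if only finitely many members contained \<open>B\<close>, then adding to \<open>B\<close> one point outside each of
  them would give an element of \<open>\<B>\<close> that no member contains (\<open>large_ideal_covers_eq\<close>). So the first inequality and the cycle

    \<open>G(N[\<A>], \<not>O) \<le> G(T, CD) \<le> G(T, \<not>\<Omega>) \<le> G(N, \<not>\<Omega>) \<le> G(N[\<A>], \<not>O)\<close>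

  are the whole theorem.

  The first step of the cycle is the one that needs normality and sequential compactness. A non-empty
  open set of \<open>MC_space \<A>\<close> contains all minimal cusco maps that agree with some \<open>\<Phi>\<close> on some \<open>A \<in> \<A>\<close>.
  When Two answers \<open>A\<close> with an open \<open>G \<supseteq> A\<close> in the covering game, she answers in the function
  space game with a minimal cusco map equal to \<open>\<Phi>\<close> on \<open>A\<close> and to \<open>{n}\<close> outside \<open>G\<close>
  (\<open>MC_modify_outside\<close>). If no \<open>G\<^sub>n\<close> contains a certain \<open>B \<in> \<B>\<close>, then the \<open>n\<close>-th map
  takes the value \<open>{n}\<close> somewhere on \<open>B\<close>. As a cusco map is bounded on a sequentially compact set,
  every \<open>1\<close>-neighbourhood over \<open>B\<close> contains only finitely many of these maps, and they form a
  closed discrete set.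

  The required map comes from gluing: \<open>\<Phi>\<close> on a smaller neighbourhood \<open>V\<close> of \<open>A\<close>, the constant
  \<open>n\<close> off the closure of \<open>V\<close>, and the interval spanned by both on the boundary give a cusco map, below
  which Zorn's lemma provides a minimal one. Passing to it loses nothing on \<open>V\<close>, because a minimal
  cusco map cannot be shrunk on an open set.

  In the remaining steps, Two passes from \<open>CD\<close> to \<open>\<not>\<Omega>\<close> by never playing the zero map, since a
  closed set without zero does not accumulate there; zero being a closed point that is not isolated,
  this restriction always leaves her a non-empty open set to choose from. Neighbourhoods of zero are
  particular open sets. Finally, from maps to covers she replaces the \<open>n\<close>-th map by the open set where its absolute value is below \<open>2\<^sup>-\<^sup>n\<close>. By largeness, if these
  sets form a \<open>\<B>\<close>-cover, then the maps accumulate at zero.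
\<close>

section \<open>Translating strategies\<close>

text \<open>The replies in the second game that simulate a history of the first game, when One follows
  \<open>\<sigma>\<close> in the second game.\<close>

definition simulated_replies ::
  "('b list \<Rightarrow> 'b set) \<Rightarrow> (nat \<Rightarrow> 'b set \<Rightarrow> 'a \<Rightarrow> 'b) \<Rightarrow> 'a list \<Rightarrow> 'b list" where
  "simulated_replies \<sigma> g h = foldl (\<lambda>bs x. bs @ [g (length bs) (\<sigma> bs) x]) [] h"

lemma length_simulated_replies [simp]: "length (simulated_replies \<sigma> g h) = length h"
  by (induction h rule: rev_induct) (simp_all add: simulated_replies_def)

lemma simulated_replies_snoc:
  "simulated_replies \<sigma> g (h @ [x]) =
     simulated_replies \<sigma> g h @ [g (length h) (\<sigma> (simulated_replies \<sigma> g h)) x]"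
proof -
  have "length (simulated_replies \<sigma> g h) = length h" by simp
  then show ?thesis by (simp add: simulated_replies_def)
qed

text \<open>Two's strategies are pulled along \<open>f\<close> and \<open>g\<close> from \<open>G\<close> to \<open>H\<close>, One's from \<open>H\<close> to \<open>G\<close>. The
  inning is a parameter of both maps because in the applications the replies have to escape to infinity,
  or to shrink to zero, as the play goes on.\<close>

lemma game_le_by_translation:
  fixes G :: "'a selection_game" and H :: "'b selection_game"
  assumes f: "\<And>n B. B \<in> moves H \<Longrightarrow> f n B \<in> moves G"
    and g: "\<And>n B x. B \<in> moves H \<Longrightarrow> x \<in> f n B \<Longrightarrow> g n B x \<in> B"
    and win: "\<And>B x. (\<And>n::nat. B n \<in> moves H) \<Longrightarrow> (\<And>n. x n \<in> f n (B n)) \<Longrightarrow>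
      range x \<in> target G \<Longrightarrow> range (\<lambda>n. g n (B n) (x n)) \<in> target H"
  shows "G \<le>\<^sub>I\<^sub>I H"
  unfolding game_le_def
proof (intro conjI impI)
  assume "Two_wins_mark G"
  then obtain \<tau> where \<tau>: "\<And>A :: nat \<Rightarrow> 'a set. (\<forall>n. A n \<in> moves G) \<Longrightarrow>
      (\<forall>n. \<tau> (A n) n \<in> A n) \<and> range (\<lambda>n. \<tau> (A n) n) \<in> target G"
    unfolding Two_wins_mark_def by metis
  show "Two_wins_mark H"
    unfolding Two_wins_mark_def
  proof (intro exI[of _ "\<lambda>B n. g n B (\<tau> (f n B) n)"] allI impI)
    fix B :: "nat \<Rightarrow> 'b set" assume B: "\<forall>n. B n \<in> moves H"
    have "(\<forall>n. \<tau> (f n (B n)) n \<in> f n (B n)) \<and> range (\<lambda>n. \<tau> (f n (B n)) n) \<in> target G"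
      using \<tau>[of "\<lambda>n. f n (B n)"] B f by blast
    then show "(\<forall>n. g n (B n) (\<tau> (f n (B n)) n) \<in> B n) \<and>
        range (\<lambda>n. g n (B n) (\<tau> (f n (B n)) n)) \<in> target H"
      using B g win[of B "\<lambda>n. \<tau> (f n (B n)) n"] by blast
  qed
next
  assume "Two_wins G"
  then obtain \<tau> where \<tau>: "\<And>A. (\<forall>n. A n \<in> moves G) \<Longrightarrow>
      (\<forall>n. \<tau> (map A [0..<Suc n]) \<in> A n) \<and> range (\<lambda>n. \<tau> (map A [0..<Suc n])) \<in> target G"
    unfolding Two_wins_def by metis
  define \<tau>' where "\<tau>' Bs = g (length Bs - 1) (last Bs) (\<tau> (map (\<lambda>i. f i (Bs ! i)) [0..<length Bs]))"
    for Bs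
  show "Two_wins H"
    unfolding Two_wins_def
  proof (intro exI[of _ \<tau>'] allI impI)
    fix B :: "nat \<Rightarrow> 'b set" assume B: "\<forall>n. B n \<in> moves H"
    define x where "x n = \<tau> (map (\<lambda>i. f i (B i)) [0..<Suc n])" for n
    have x: "(\<forall>n. x n \<in> f n (B n)) \<and> range x \<in> target G"
      using \<tau>[of "\<lambda>i. f i (B i)"] B f unfolding x_def by blast
    have map_eq: "map (\<lambda>i. f i (map B [0..<Suc n] ! i)) [0..<Suc n] = map (\<lambda>i. f i (B i)) [0..<Suc n]" for n
      by (rule map_cong) (auto simp del: upt_Suc)
    have last_eq: "last (map B [0..<Suc n]) = B n" for n by simp
    have "\<tau>' (map B [0..<Suc n]) = g n (B n) (x n)" for n
      unfolding \<tau>'_def x_def by (simp only: length_map length_upt diff_zero diff_Suc_1 map_eq last_eq)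
    then show "(\<forall>n. \<tau>' (map B [0..<Suc n]) \<in> B n) \<and>
        range (\<lambda>n. \<tau>' (map B [0..<Suc n])) \<in> target H"
      using x B g win[of B x] by simp
  qed
next
  assume not_One: "\<not> One_wins G"
  show "\<not> One_wins H"
  proof
    assume "One_wins H"
    then obtain \<sigma> where \<sigma>: "\<And>h. \<sigma> h \<in> moves H"
      and \<sigma>_wins: "\<And>y. (\<And>n. y n \<in> \<sigma> (map y [0..<n])) \<Longrightarrow> range y \<notin> target H"
      unfolding One_wins_def by metis
    define \<sigma>' where "\<sigma>' h = f (length h) (\<sigma> (simulated_replies \<sigma> g h))" for h
    have "One_wins G"
      unfolding One_wins_def
    proof (intro exI[of _ \<sigma>'] conjI allI impI)
      show "\<sigma>' h \<in> moves G" for h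
        unfolding \<sigma>'_def using \<sigma> f by blast
    next
      fix x :: "nat \<Rightarrow> 'a" assume x: "\<forall>n. x n \<in> \<sigma>' (map x [0..<n])"
      define B where "B n = \<sigma> (simulated_replies \<sigma> g (map x [0..<n]))" for n
      define y where "y n = g n (B n) (x n)" for n
      have replies: "simulated_replies \<sigma> g (map x [0..<n]) = map y [0..<n]" for n
      proof (induction n)
        case 0
        then show ?case by (simp add: simulated_replies_def)
      next
        case (Suc n)
        then show ?case
          by (simp add: simulated_replies_snoc y_def B_def)
      qed
      have x_f: "x n \<in> f n (B n)" for n
        using x unfolding \<sigma>'_def B_def by (metis length_map length_upt diff_zero)
      have "y n \<in> \<sigma> (map y [0..<n])" for n
        using g[OF _ x_f] \<sigma> unfolding y_def[symmetric] by (metis B_def replies)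
      then have "range y \<notin> target H" by (rule \<sigma>_wins)
      then show "range x \<notin> target G"
        using win[of B x] \<sigma> x_f unfolding y_def[abs_def] B_def by blast
    qed
    with not_One show False by blast
  qed
next
  assume not_One: "\<not> One_wins_pre G"
  show "\<not> One_wins_pre H"
  proof
    assume "One_wins_pre H"
    then obtain \<sigma> where \<sigma>: "\<And>n. \<sigma> n \<in> moves H"
      and \<sigma>_wins: "\<And>y :: nat \<Rightarrow> 'b. (\<And>n. y n \<in> \<sigma> n) \<Longrightarrow> range y \<notin> target H"
      unfolding One_wins_pre_def by metis
    have "One_wins_pre G"
      unfolding One_wins_pre_def
    proof (intro exI[of _ "\<lambda>n. f n (\<sigma> n)"] conjI allI impI)
      show "f n (\<sigma> n) \<in> moves G" for n
        using \<sigma> f by blast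
    next
      fix x :: "nat \<Rightarrow> 'a" assume x: "\<forall>n. x n \<in> f n (\<sigma> n)"
      then have "range (\<lambda>n. g n (\<sigma> n) (x n)) \<notin> target H"
        using \<sigma> g by (intro \<sigma>_wins) blast
      then show "range x \<notin> target G"
        using win[of \<sigma> x] \<sigma> x by blast
    qed
    with not_One show False by blast
  qed
qed

lemma game_le_trans [trans]: "G \<le>\<^sub>I\<^sub>I H \<Longrightarrow> H \<le>\<^sub>I\<^sub>I K \<Longrightarrow> G \<le>\<^sub>I\<^sub>I K"
  unfolding game_le_def by blast

section \<open>Ideal covers\<close>

text \<open>Given finitely many proper open sets containing \<open>A\<close>, enlarge \<open>A\<close> by a point outside each of
  them: whatever covers the larger set is a further member containing \<open>A\<close>.\<close>

lemma large_ideal_covers_eq: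
  fixes \<A> :: "'a::topological_space set set"
  assumes "closed_ideal \<A>"
  shows "large_ideal_covers \<A> = ideal_covers \<A>"
proof -
  have "infinite {U\<in>\<U>. A \<subseteq> U}" if \<U>: "\<U> \<in> ideal_covers \<A>" and A: "A \<in> \<A>" for \<U> A
  proof
    assume fin: "finite {U\<in>\<U>. A \<subseteq> U}"
    have add_points: "A \<union> F \<in> \<A>" if "finite F" for F
      using that
    proof (induction F)
      case empty
      then show ?case using A by simp
    next
      case (insert p F)
      have "{p} \<union> (A \<union> F) \<in> \<A>"
        using assms insert.IH unfolding closed_ideal_def by metis
      then show ?case by simp
    qed
    have "\<exists>p. p \<notin> U" if "U \<in> \<U>" for U
      using \<U> that unfolding ideal_covers_def by (metis (lifting) UNIV_eq_I mem_Collect_eq)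
    then obtain p where p: "\<And>U. U \<in> \<U> \<Longrightarrow> p U \<notin> U" by metis
    have "\<forall>B\<in>\<A>. \<exists>U\<in>\<U>. B \<subseteq> U"
      using \<U> by (simp add: ideal_covers_def)
    from bspec[OF this add_points[OF finite_imageI[OF fin]], of p]
    obtain U where "U \<in> \<U>" and U: "A \<union> p ` {U\<in>\<U>. A \<subseteq> U} \<subseteq> U" by (rule bexE)
    then have "p U \<in> U" by blast
    with p \<open>U \<in> \<U>\<close> show False by blast
  qed
  then show ?thesis
    unfolding large_ideal_covers_def by blast
qed

lemma proper_opens_ideal_cover_iff:
  assumes "closed_ideal \<B>" "\<U> \<subseteq> proper_opens euclidean"
  shows "\<U> \<in> ideal_covers \<B> \<longleftrightarrow> (\<forall>B\<in>\<B>. \<exists>U\<in>\<U>. B \<subseteq> U)"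
proof
  assume "\<forall>B\<in>\<B>. \<exists>U\<in>\<U>. B \<subseteq> U"
  moreover have "{x} \<in> \<B>" for x
    using assms(1) unfolding closed_ideal_def by blast
  ultimately have "\<Union>\<U> = UNIV" by blast
  with \<open>\<forall>B\<in>\<B>. \<exists>U\<in>\<U>. B \<subseteq> U\<close> assms(2) show "\<U> \<in> ideal_covers \<B>"
    unfolding ideal_covers_def proper_opens_def by auto
qed (simp add: ideal_covers_def)

section \<open>Cusco maps\<close>

lemma cusco_nonempty: "cusco \<Phi> \<Longrightarrow> \<Phi> x \<noteq> {}"
  and cusco_compact: "cusco \<Phi> \<Longrightarrow> compact (\<Phi> x)"
  and cusco_convex: "cusco \<Phi> \<Longrightarrow> convex (\<Phi> x)"
  and cusco_open: "cusco \<Phi> \<Longrightarrow> open V \<Longrightarrow> open {x. \<Phi> x \<subseteq> V}"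
  by (simp_all add: cusco_def)

lemma set_graph_subset_iff: "set_graph \<Psi> \<subseteq> set_graph \<Phi> \<longleftrightarrow> (\<forall>x. \<Psi> x \<subseteq> \<Phi> x)"
  unfolding set_graph_def by blast

lemma set_graph_eq_iff: "set_graph \<Psi> = set_graph \<Phi> \<longleftrightarrow> \<Psi> = \<Phi>"
  unfolding set_graph_def by (auto simp: fun_eq_iff set_eq_iff)

lemma MC_iff: "\<Phi> \<in> MC \<longleftrightarrow> cusco \<Phi> \<and> (\<forall>\<Psi>. cusco \<Psi> \<and> (\<forall>x. \<Psi> x \<subseteq> \<Phi> x) \<longrightarrow> \<Psi> = \<Phi>)"
  unfolding MC_def by (simp add: set_graph_subset_iff set_graph_eq_iff)

lemma MC_cusco: "\<Phi> \<in> MC \<Longrightarrow> cusco \<Phi>"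
  by (simp add: MC_iff)

lemma MC_const: "(\<lambda>_. {c}) \<in> MC"
  unfolding MC_iff
proof (intro conjI allI impI)
  show "cusco (\<lambda>_. {c})"
    by (simp add: cusco_def)
  fix \<Psi> :: "'a \<Rightarrow> real set" assume "cusco \<Psi> \<and> (\<forall>x. \<Psi> x \<subseteq> {c})"
  then show "\<Psi> = (\<lambda>_. {c})"
    by (metis cusco_nonempty subset_singletonD)
qed

text \<open>By compactness, once the intersection of a chain of values lies in an open set, so does one of
  them; hence upper semicontinuity and non-emptiness survive at limit stages.\<close>

lemma cusco_INT_chain:
  assumes "F \<noteq> {}" and cusco: "\<And>\<Phi>. \<Phi> \<in> F \<Longrightarrow> cusco \<Phi>"
    and chain: "\<And>\<Phi> \<Psi>. \<Phi> \<in> F \<Longrightarrow> \<Psi> \<in> F \<Longrightarrow> (\<forall>x. \<Phi> x \<subseteq> \<Psi> x) \<or> (\<forall>x. \<Psi> x \<subseteq> \<Phi> x)"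
  shows "cusco (\<lambda>x. \<Inter>\<Phi>\<in>F. \<Phi> x)"
proof -
  have some: "\<exists>\<Phi>\<in>F. \<Phi> x \<subseteq> V" if "open V" "(\<Inter>\<Phi>\<in>F. \<Phi> x) \<subseteq> V" for x V
  proof (rule ccontr)
    assume none: "\<not> (\<exists>\<Phi>\<in>F. \<Phi> x \<subseteq> V)"
    have "\<Inter>((\<lambda>\<Phi>. \<Phi> x - V) ` F) \<noteq> {}"
    proof (rule compact_chain)
      show "compact S" if "S \<in> (\<lambda>\<Phi>. \<Phi> x - V) ` F" for S
        using that cusco cusco_compact \<open>open V\<close> by (auto intro: compact_diff)
      show "{} \<notin> (\<lambda>\<Phi>. \<Phi> x - V) ` F"
        using none by blast
      show "S \<subseteq> T \<or> T \<subseteq> S"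
        if "S \<in> (\<lambda>\<Phi>. \<Phi> x - V) ` F \<and> T \<in> (\<lambda>\<Phi>. \<Phi> x - V) ` F" for S T
        using that chain by fast
    qed
    with that(2) \<open>F \<noteq> {}\<close> show False by blast
  qed
  have "open {x. (\<Inter>\<Phi>\<in>F. \<Phi> x) \<subseteq> V}" if "open V" for V
  proof -
    have "{x. (\<Inter>\<Phi>\<in>F. \<Phi> x) \<subseteq> V} = (\<Union>\<Phi>\<in>F. {x. \<Phi> x \<subseteq> V})"
      using some[OF that] by blast
    moreover have "open (\<Union>\<Phi>\<in>F. {x. \<Phi> x \<subseteq> V})"
      by (intro open_UN ballI cusco_open[OF cusco that])
    ultimately show ?thesis by metis
  qed
  moreover have "(\<Inter>\<Phi>\<in>F. \<Phi> x) \<noteq> {}" for x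
    using some[of "{}" x] cusco cusco_nonempty by (metis open_empty subset_empty)
  moreover have "compact (\<Inter>\<Phi>\<in>F. \<Phi> x)" for x
    using \<open>F \<noteq> {}\<close> cusco cusco_compact by (intro compact_Inter) auto
  moreover have "convex (\<Inter>\<Phi>\<in>F. \<Phi> x)" for x
    using cusco cusco_convex by (intro convex_INT) auto
  ultimately show ?thesis
    unfolding cusco_def by blast
qed

lemma exists_MC_below:
  assumes "cusco \<Phi>"
  shows "\<exists>\<Psi>\<in>MC. \<forall>x. \<Psi> x \<subseteq> \<Phi> x"
proof -
  \<comment> \<open>Minimal graphs are maximal complements of graphs.\<close>
  define S where "S = {- set_graph \<Psi> | \<Psi>. cusco \<Psi> \<and> (\<forall>x. \<Psi> x \<subseteq> \<Phi> x)}"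
  have "\<exists>M\<in>S. \<forall>X\<in>S. M \<subseteq> X \<longrightarrow> X = M"
  proof (rule subset_Zorn_nonempty)
    show "S \<noteq> {}" using assms unfolding S_def by blast
  next
    fix C assume "C \<noteq> {}" and "subset.chain S C"
    then have CS: "C \<subseteq> S" and lin: "\<And>X Y. X \<in> C \<Longrightarrow> Y \<in> C \<Longrightarrow> X \<subseteq> Y \<or> Y \<subseteq> X"
      by (auto simp: subset_chain_def)
    define F where "F = {\<Psi>. cusco \<Psi> \<and> (\<forall>x. \<Psi> x \<subseteq> \<Phi> x) \<and> - set_graph \<Psi> \<in> C}"
    have C: "C = (\<lambda>\<Psi>. - set_graph \<Psi>) ` F"
      using CS unfolding F_def S_def by blast
    have "cusco (\<lambda>x. \<Inter>\<Psi>\<in>F. \<Psi> x)"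
    proof (rule cusco_INT_chain)
      show "F \<noteq> {}" using C \<open>C \<noteq> {}\<close> by blast
      show "cusco \<Psi>" if "\<Psi> \<in> F" for \<Psi> using that F_def by blast
      show "(\<forall>x. \<Psi> x \<subseteq> \<Theta> x) \<or> (\<forall>x. \<Theta> x \<subseteq> \<Psi> x)" if "\<Psi> \<in> F" "\<Theta> \<in> F" for \<Psi> \<Theta>
        using lin[of "- set_graph \<Psi>" "- set_graph \<Theta>"] that
        unfolding F_def by (auto simp: set_graph_subset_iff)
    qed
    moreover have "(\<Inter>\<Psi>\<in>F. \<Psi> x) \<subseteq> \<Phi> x" for x
      using C \<open>C \<noteq> {}\<close> unfolding F_def by blast
    moreover have "\<Union>C = - set_graph (\<lambda>x. \<Inter>\<Psi>\<in>F. \<Psi> x)"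
      unfolding C set_graph_def by blast
    ultimately show "\<Union>C \<in> S" unfolding S_def by blast
  qed
  then obtain \<Psi> where \<Psi>: "cusco \<Psi>" "\<forall>x. \<Psi> x \<subseteq> \<Phi> x"
    and max: "\<forall>X\<in>S. - set_graph \<Psi> \<subseteq> X \<longrightarrow> X = - set_graph \<Psi>"
    unfolding S_def by blast
  have "\<Theta> = \<Psi>" if "cusco \<Theta>" "\<forall>x. \<Theta> x \<subseteq> \<Psi> x" for \<Theta>
  proof -
    have "- set_graph \<Theta> \<in> S"
      unfolding S_def using that \<Psi>(2) by blast
    moreover have "- set_graph \<Psi> \<subseteq> - set_graph \<Theta>"
      using that(2) set_graph_subset_iff[of \<Theta> \<Psi>] by blast
    ultimately have "- set_graph \<Theta> = - set_graph \<Psi>"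
      using max by blast
    then show ?thesis by (simp add: set_graph_eq_iff)
  qed
  then have "\<Psi> \<in> MC"
    using \<Psi>(1) unfolding MC_iff by metis
  with \<Psi>(2) show ?thesis by metis
qed

text \<open>Shrinking a cusco map only on an open set leaves it upper semicontinuous, so the values of
  \<open>\<Psi>\<close> inside \<open>W\<close> and those of \<open>\<Phi>\<close> outside form a cusco map below \<open>\<Phi>\<close>.\<close>

lemma MC_rigid_on_open:
  assumes \<Phi>: "\<Phi> \<in> MC" and \<Psi>: "cusco \<Psi>" and W: "open W"
    and sub: "\<And>x. x \<in> W \<Longrightarrow> \<Psi> x \<subseteq> \<Phi> x" and "x \<in> W"
  shows "\<Psi> x = \<Phi> x"
proof -
  define \<Theta> where "\<Theta> x = (if x \<in> W then \<Psi> x else \<Phi> x)" for x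
  have "cusco \<Theta>"
    unfolding cusco_def
  proof (intro conjI allI impI)
    show "\<Theta> x \<noteq> {}" "compact (\<Theta> x)" "convex (\<Theta> x)" for x
      using \<Psi> MC_cusco[OF \<Phi>] by (auto simp: \<Theta>_def cusco_def)
  next
    fix V :: "real set" assume V: "open V"
    have "{x. \<Theta> x \<subseteq> V} = {x. \<Phi> x \<subseteq> V} \<union> (W \<inter> {x. \<Psi> x \<subseteq> V})"
      using sub by (auto simp: \<Theta>_def)
    then show "open {x. \<Theta> x \<subseteq> V}"
      using W cusco_open[OF \<Psi> V] cusco_open[OF MC_cusco[OF \<Phi>] V] by auto
  qed
  moreover have "\<Theta> x \<subseteq> \<Phi> x" for x
    using sub by (simp add: \<Theta>_def)
  ultimately have "\<Theta> = \<Phi>"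
    using \<Phi> unfolding MC_iff by blast
  then show ?thesis
    using \<open>x \<in> W\<close> by (metis \<Theta>_def)
qed

text \<open>On the boundary of \<open>V\<close> the value has to contain both \<open>\<Phi> x\<close> and \<open>c\<close>, so there it is their convex
  hull. Hulls are compatible with upper semicontinuity because a compact interval inside an open set
  has an open interval around it that still fits.\<close>

lemma cusco_glue_const:
  assumes \<Phi>: "cusco \<Phi>" and V: "open V"
  shows "cusco (\<lambda>x. if x \<in> V then \<Phi> x else if x \<in> closure V then convex hull (insert c (\<Phi> x)) else {c})"
    (is "cusco ?\<Theta>")
  unfolding cusco_def
proof (intro conjI allI impI)
  show "?\<Theta> x \<noteq> {}" for x
    using cusco_nonempty[OF \<Phi>] by simp
  show "compact (?\<Theta> x)" for x
    using cusco_compact[OF \<Phi>] by (simp add: compact_convex_hull)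
  show "convex (?\<Theta> x)" for x
    using cusco_convex[OF \<Phi>] by simp
next
  fix Z :: "real set" assume Z: "open Z"
  show "open {x. ?\<Theta> x \<subseteq> Z}"
  proof (subst open_subopen, intro ballI)
    fix x assume "x \<in> {x. ?\<Theta> x \<subseteq> Z}"
    then have x: "?\<Theta> x \<subseteq> Z" by simp
    consider "x \<in> V" | "x \<notin> closure V" | "x \<notin> V" "x \<in> closure V" by blast
    then show "\<exists>T. open T \<and> x \<in> T \<and> T \<subseteq> {x. ?\<Theta> x \<subseteq> Z}"
    proof cases
      case 1
      have "open (V \<inter> {x. \<Phi> x \<subseteq> Z})"
        using V cusco_open[OF \<Phi> Z] by blast
      moreover have "V \<inter> {x. \<Phi> x \<subseteq> Z} \<subseteq> {x. ?\<Theta> x \<subseteq> Z}" by auto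
      ultimately show ?thesis using 1 x by fastforce
    next
      case 2
      then have "c \<in> Z" using x closure_subset[of V] by (auto split: if_splits)
      then have "- closure V \<subseteq> {x. ?\<Theta> x \<subseteq> Z}" using closure_subset[of V] by auto
      then show ?thesis using 2 by (intro exI[of _ "- closure V"]) auto
    next
      case 3
      define K where "K = convex hull (insert c (\<Phi> x))"
      have "compact K" "K \<subseteq> Z"
        using 3 x cusco_compact[OF \<Phi>] by (auto simp: K_def compact_convex_hull)
      then obtain e where e: "e > 0" "(\<Union>y\<in>K. ball y e) \<subseteq> Z"
        using compact_subset_open_imp_ball_epsilon_subset Z by metis
      define I where "I = (\<Union>y\<in>K. \<Union>z\<in>ball 0 e. {y + z})"
      have I_eq: "I = (\<Union>y\<in>K. ball y e)"
      proof -
        have "(\<Union>z\<in>ball 0 e. {y + z}) = (+) y ` ball 0 e" for y :: real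
          by (rule UNION_singleton_eq_range)
        then show ?thesis unfolding I_def by simp
      qed
      have "convex I"
        unfolding I_def K_def by (intro convex_sums) (auto simp: convex_convex_hull)
      have "open I" "I \<subseteq> Z"
        using e I_eq by auto
      have "K \<subseteq> I"
        using e(1) I_eq by auto
      then have "insert c (\<Phi> x) \<subseteq> I"
        using hull_subset[of "insert c (\<Phi> x)" convex] unfolding K_def by blast
      have "{x. \<Phi> x \<subseteq> I} \<subseteq> {x. ?\<Theta> x \<subseteq> Z}"
      proof
        fix y assume "y \<in> {x. \<Phi> x \<subseteq> I}"
        then have "insert c (\<Phi> y) \<subseteq> I"
          using \<open>insert c (\<Phi> x) \<subseteq> I\<close> by simp
        moreover from this have "convex hull (insert c (\<Phi> y)) \<subseteq> I"
          using \<open>convex I\<close> by (rule hull_minimal)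
        ultimately show "y \<in> {x. ?\<Theta> x \<subseteq> Z}"
          using \<open>I \<subseteq> Z\<close> by auto
      qed
      then show ?thesis
        using cusco_open[OF \<Phi> \<open>open I\<close>] \<open>insert c (\<Phi> x) \<subseteq> I\<close> by blast
    qed
  qed
qed

text \<open>A minimal map below the glued one is still \<open>\<Phi>\<close> on the open set \<open>V\<close> by rigidity, and off the
  closure of \<open>V\<close> the glued value is a singleton already.\<close>

lemma MC_modify_outside:
  assumes \<Phi>: "\<Phi> \<in> MC" and "ideal_normal \<A>" "A \<in> \<A>" "open G" "A \<subseteq> G"
  shows "\<exists>\<Psi>\<in>MC. (\<forall>x\<in>A. \<Psi> x = \<Phi> x) \<and> (\<forall>x. x \<notin> G \<longrightarrow> \<Psi> x = {c})"
proof -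
  obtain V where V: "open V" "A \<subseteq> V" "closure V \<subseteq> G"
    using assms(2-5) unfolding ideal_normal_def by metis
  from exists_MC_below[OF cusco_glue_const[OF MC_cusco[OF \<Phi>] V(1), of c]]
  obtain \<Psi> where \<Psi>: "\<Psi> \<in> MC" "\<And>x. \<Psi> x \<subseteq>
      (if x \<in> V then \<Phi> x else if x \<in> closure V then convex hull (insert c (\<Phi> x)) else {c})"
    by (elim bexE) (rule that, assumption, erule spec)
  have "\<Psi> x = \<Phi> x" if "x \<in> A" for x
  proof (rule MC_rigid_on_open[OF \<Phi> MC_cusco[OF \<Psi>(1)] V(1)])
    show "\<Psi> x \<subseteq> \<Phi> x" if "x \<in> V" for x
      using \<Psi>(2)[of x] that by simp
    show "x \<in> V" using that V(2) by blast
  qed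
  moreover have "\<Psi> x = {c}" if "x \<notin> G" for x
  proof -
    have "x \<notin> closure V" using that V(3) by blast
    then have "\<Psi> x \<subseteq> {c}"
      using \<Psi>(2)[of x] closure_subset[of V] by (auto split: if_splits)
    then show ?thesis
      using cusco_nonempty[OF MC_cusco[OF \<Psi>(1)]] by blast
  qed
  ultimately show ?thesis using \<Psi>(1) by blast
qed

lemma cusco_bounded_on_seq_compact:
  assumes \<Phi>: "cusco \<Phi>" and B: "seq_compact B"
  shows "\<exists>M. \<forall>x\<in>B. \<Phi> x \<subseteq> ball 0 M"
proof (rule ccontr)
  assume "\<not> ?thesis"
  then have "\<forall>n. \<exists>x\<in>B. \<not> \<Phi> x \<subseteq> ball 0 (real n)" by blast
  then obtain s where s: "\<And>n. s n \<in> B" "\<And>n. \<not> \<Phi> (s n) \<subseteq> ball 0 (real n)" by metis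
  obtain l r where l: "l \<in> B" "strict_mono r" "(s \<circ> r) \<longlonglongrightarrow> l"
    using seq_compactE[OF B] s(1) by metis
  obtain M where M: "\<Phi> l \<subseteq> ball 0 M"
    using compact_imp_bounded[OF cusco_compact[OF \<Phi>]] bounded_subset_ballD by blast
  have "\<forall>\<^sub>F n in sequentially. (s \<circ> r) n \<in> {x. \<Phi> x \<subseteq> ball 0 M}"
    using M by (intro topological_tendstoD[OF l(3) cusco_open[OF \<Phi> open_ball]] CollectI)
  moreover have "\<forall>\<^sub>F n in sequentially. real n \<ge> M"
    using filterlim_real_sequentially unfolding filterlim_at_top by blast
  ultimately have "\<forall>\<^sub>F n in sequentially. False"
  proof eventually_elim
    case (elim n)
    then have "M \<le> real (r n)"
      using seq_suble[OF l(2), of n] by linarith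
    then have "ball 0 M \<subseteq> ball (0::real) (real (r n))" by (rule subset_ball)
    with elim(1) s(2)[of "r n"] show ?case by auto
  qed
  then show False by simp
qed

section \<open>The spaces of minimal cusco maps\<close>

lemma MC_entourage_uniformity:
  "A \<in> \<A> \<Longrightarrow> \<epsilon> > 0 \<Longrightarrow> MC_entourage A \<epsilon> \<in> MC_uniformity \<A>"
  unfolding MC_uniformity_def MC_entourage_def by blast

lemma MC_entourage_agree:
  assumes "\<Phi> \<in> MC" "\<Psi> \<in> MC" "\<epsilon> > 0" "\<And>x. x \<in> A \<Longrightarrow> \<Psi> x = \<Phi> x"
  shows "(\<Phi>, \<Psi>) \<in> MC_entourage A \<epsilon>"
  using assms by (force simp: MC_entourage_def)

lemma openin_MC_space_entourage:
  assumes "closed_ideal \<A>"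
  shows "openin (MC_space \<A>) G \<longleftrightarrow>
    G \<subseteq> MC \<and> (\<forall>\<Phi>\<in>G. \<exists>A\<in>\<A>. \<exists>\<epsilon>>0. MC_entourage A \<epsilon> `` {\<Phi>} \<subseteq> G)"
proof -
  have "(\<exists>E\<in>MC_uniformity \<A>. E `` {\<Phi>} \<subseteq> G) \<longleftrightarrow> (\<exists>A\<in>\<A>. \<exists>\<epsilon>>0. MC_entourage A \<epsilon> `` {\<Phi>} \<subseteq> G)" for \<Phi>
  proof
    assume "\<exists>E\<in>MC_uniformity \<A>. E `` {\<Phi>} \<subseteq> G"
    then obtain E A \<epsilon> where "E `` {\<Phi>} \<subseteq> G" "A \<in> \<A>" "\<epsilon> > 0" "MC_entourage A \<epsilon> \<subseteq> E"
      unfolding MC_uniformity_def by blast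
    then show "\<exists>A\<in>\<A>. \<exists>\<epsilon>>0. MC_entourage A \<epsilon> `` {\<Phi>} \<subseteq> G" by blast
  qed (blast intro: MC_entourage_uniformity)
  then show ?thesis
    by (simp add: openin_MC_space[OF assms])
qed

lemma MC_separated:
  assumes "closed_ideal \<A>" "\<Phi> \<in> MC" "\<Psi> \<in> MC" "\<Psi> \<noteq> \<Phi>"
  shows "\<exists>E\<in>MC_uniformity \<A>. (\<Phi>, \<Psi>) \<notin> E"
proof -
  obtain x where x: "\<Phi> x \<noteq> \<Psi> x"
    using assms(4) by (metis ext)
  have gap: "\<exists>\<epsilon>>0. \<not> S \<subseteq> (\<Union>y\<in>T. ball y \<epsilon>)" if ST: "\<not> S \<subseteq> T" "compact T" for S T :: "real set"
  proof -
    obtain y where y: "y \<in> S" "y \<in> - T" using ST(1) by blast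
    have "open (- T)" using ST(2) by (simp add: compact_imp_closed open_Compl)
    then obtain \<epsilon> where "\<epsilon> > 0" "ball y \<epsilon> \<subseteq> - T"
      using y(2) open_contains_ball by blast
    then have "y \<notin> (\<Union>z\<in>T. ball z \<epsilon>)"
      by (force simp: dist_commute)
    then show ?thesis
      using y(1) \<open>\<epsilon> > 0\<close> by blast
  qed
  have "\<not> \<Phi> x \<subseteq> \<Psi> x \<or> \<not> \<Psi> x \<subseteq> \<Phi> x"
    using x by blast
  then obtain \<epsilon> where "\<epsilon> > 0"
    "\<not> \<Phi> x \<subseteq> (\<Union>y\<in>\<Psi> x. ball y \<epsilon>) \<or> \<not> \<Psi> x \<subseteq> (\<Union>y\<in>\<Phi> x. ball y \<epsilon>)"
    using gap cusco_compact MC_cusco assms(2,3) by metis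
  then have "(\<Phi>, \<Psi>) \<notin> MC_entourage {x} \<epsilon>"
    by (simp add: MC_entourage_def)
  moreover have "{x} \<in> \<A>"
    using assms(1) unfolding closed_ideal_def by blast
  ultimately show ?thesis
    using \<open>\<epsilon> > 0\<close> MC_entourage_uniformity by blast
qed

text \<open>The hypothesis passes to subsets of \<open>D\<close>, so it suffices to see that \<open>D\<close> is closed; the finitely
  many members of \<open>D\<close> near a point outside are removed one at a time by separation.\<close>

lemma locally_finite_closed_discrete:
  fixes \<A> :: "'a::topological_space set set"
  assumes \<A>: "closed_ideal \<A>" and D: "D \<subseteq> MC"
    and fin: "\<And>\<Phi>. \<Phi> \<in> MC \<Longrightarrow> \<exists>E\<in>MC_uniformity \<A>. finite (E `` {\<Phi>} \<inter> D)"
  shows "D \<in> closed_discrete_sets (MC_space \<A>)"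
proof -
  have closed: "closedin (MC_space \<A>) S" if S: "S \<subseteq> D" for S
    unfolding closedin_def topspace_MC_space[OF \<A>] openin_MC_space[OF \<A>]
  proof (intro conjI ballI)
    show "S \<subseteq> MC" using S D by blast
    fix \<Phi> assume \<Phi>: "\<Phi> \<in> MC - S"
    obtain E where E: "E \<in> MC_uniformity \<A>" "finite (E `` {\<Phi>} \<inter> D)"
      using fin \<Phi> by blast
    have avoid: "\<exists>E'\<in>MC_uniformity \<A>. E' \<subseteq> E \<and> E' `` {\<Phi>} \<inter> P = {}" if "finite P" "P \<subseteq> S" for P
      using that
    proof (induction P)
      case empty
      then show ?case using E(1) by blast
    next
      case (insert \<Psi> P)
      then obtain E' where E': "E' \<in> MC_uniformity \<A>" "E' \<subseteq> E" "E' `` {\<Phi>} \<inter> P = {}" by blast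
      obtain E'' where E'': "E'' \<in> MC_uniformity \<A>" "(\<Phi>, \<Psi>) \<notin> E''"
        using MC_separated[OF \<A>, of \<Phi> \<Psi>] insert.prems \<Phi> S D by blast
      have "(E' \<inter> E'') `` {\<Phi>} \<inter> insert \<Psi> P = {}"
        using E'(3) E''(2) by blast
      moreover have "E' \<inter> E'' \<subseteq> E" using E'(2) by blast
      ultimately show ?case
        using MC_uniformity_Int[OF \<A> E'(1) E''(1)] by (intro bexI conjI)
    qed
    have "finite (E `` {\<Phi>} \<inter> S)"
      by (rule finite_subset[OF _ E(2)]) (use S in blast)
    then obtain E' where E': "E' \<in> MC_uniformity \<A>" "E' \<subseteq> E" "E' `` {\<Phi>} \<inter> (E `` {\<Phi>} \<inter> S) = {}"
      using avoid by blast
    have "E' `` {\<Phi>} \<subseteq> MC - S"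
    proof
      fix \<Psi> assume "\<Psi> \<in> E' `` {\<Phi>}"
      moreover have "E' \<subseteq> MC \<times> MC" using E'(1) unfolding MC_uniformity_def by blast
      ultimately show "\<Psi> \<in> MC - S" using E'(2,3) by blast
    qed
    then show "\<exists>E\<in>MC_uniformity \<A>. E `` {\<Phi>} \<subseteq> MC - S" using E'(1) by blast
  qed simp
  have "openin (subtopology (MC_space \<A>) D) S" if "S \<subseteq> D" for S
  proof -
    have "openin (MC_space \<A>) (topspace (MC_space \<A>) - (D - S))"
      using closed[of "D - S"] by blast
    moreover have "S = (topspace (MC_space \<A>) - (D - S)) \<inter> D"
      using that D topspace_MC_space[OF \<A>] by blast
    ultimately show ?thesis
      unfolding openin_subtopology by blast
  qed
  moreover have "topspace (subtopology (MC_space \<A>) D) = D"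
    using D topspace_MC_space[OF \<A>] by auto
  ultimately have "subtopology (MC_space \<A>) D = discrete_topology D"
    by (metis discrete_topology_unique_alt order_refl Int_absorb openin_subset
        openin_discrete_topology topology_eq)
  with closed[of D] show ?thesis
    unfolding closed_discrete_sets_def by blast
qed

text \<open>The zero map is a closed point by separation, and it is not isolated because each of its
  neighbourhoods contains further constant maps.\<close>

lemma openin_remove_zero:
  assumes \<A>: "closed_ideal \<A>" and U: "openin (MC_space \<A>) U" "U \<noteq> {}"
  shows "U - {\<lambda>_. {0}} \<in> proper_opens (MC_space \<A>)"
proof -
  have U': "U \<subseteq> MC" "\<And>\<Phi>. \<Phi> \<in> U \<Longrightarrow> \<exists>E\<in>MC_uniformity \<A>. E `` {\<Phi>} \<subseteq> U"
    using U(1) unfolding openin_MC_space[OF \<A>] by blast+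
  have "openin (MC_space \<A>) (U - {\<lambda>_. {0}})"
    unfolding openin_MC_space[OF \<A>]
  proof (intro conjI ballI)
    show "U - {\<lambda>_. {0}} \<subseteq> MC" using U'(1) by blast
    fix \<Phi> assume \<Phi>: "\<Phi> \<in> U - {\<lambda>_. {0}}"
    then have "\<Phi> \<in> U" by blast
    from U'(2)[OF this] obtain E where E: "E \<in> MC_uniformity \<A>" "E `` {\<Phi>} \<subseteq> U" by blast
    obtain E' where E': "E' \<in> MC_uniformity \<A>" "(\<Phi>, \<lambda>_. {0}) \<notin> E'"
      using MC_separated[OF \<A> _ MC_const, of \<Phi> 0] \<Phi> U'(1) by blast
    have "(E \<inter> E') `` {\<Phi>} \<subseteq> U - {\<lambda>_. {0}}"
      using E(2) E'(2) by blast
    then show "\<exists>E\<in>MC_uniformity \<A>. E `` {\<Phi>} \<subseteq> U - {\<lambda>_. {0}}"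
      using MC_uniformity_Int[OF \<A> E(1) E'(1)] by blast
  qed
  moreover have "U - {\<lambda>_. {0}} \<noteq> {}"
  proof (cases "(\<lambda>_. {0}) \<in> U")
    case True
    then obtain A \<epsilon> where A: "A \<in> \<A>" "\<epsilon> > 0" "MC_entourage A \<epsilon> `` {\<lambda>_. {0}} \<subseteq> U"
      using U(1) unfolding openin_MC_space_entourage[OF \<A>] by blast
    obtain c where c: "0 < c" "c < \<epsilon>"
      using dense[OF A(2)] by blast
    then have "(\<lambda>_. {0}, \<lambda>_. {c}) \<in> MC_entourage A \<epsilon>"
      by (simp add: MC_entourage_def MC_const)
    then have "(\<lambda>_. {c}) \<in> U" using A(3) by blast
    moreover have "(\<lambda>_::'a. {c}) \<noteq> (\<lambda>_. {0})"
      using c(1) by (metis less_irrefl singleton_inject)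
    ultimately show ?thesis by blast
  next
    case False
    then show ?thesis using U(2) by blast
  qed
  moreover have "U - {\<lambda>_. {0}} \<noteq> topspace (MC_space \<A>)"
    using MC_const[of 0] topspace_MC_space[OF \<A>] by blast
  ultimately show ?thesis
    unfolding proper_opens_def by blast
qed

text \<open>The condition \<open>\<Phi> x \<subseteq> ball 0 \<epsilon>\<close> on \<open>A\<close> alone is not an open one, because the values may
  approach the bound along \<open>A\<close>; hence the uniform margin \<open>\<delta> < \<epsilon>\<close>.\<close>

definition near_zero :: "'a::topological_space set \<Rightarrow> real \<Rightarrow> ('a \<Rightarrow> real set) set" where
  "near_zero A \<epsilon> = {\<Phi> \<in> MC. \<exists>\<delta><\<epsilon>. \<forall>x\<in>A. \<Phi> x \<subseteq> ball 0 \<delta>}"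

lemma near_zero_point_nbhd:
  assumes \<A>: "closed_ideal \<A>" and A: "A \<in> \<A>" and "\<epsilon> > 0"
  shows "near_zero A \<epsilon> \<in> point_nbhds (MC_space \<A>) (\<lambda>_. {0})"
proof -
  have "openin (MC_space \<A>) (near_zero A \<epsilon>)"
    unfolding openin_MC_space_entourage[OF \<A>]
  proof (intro conjI ballI)
    show "near_zero A \<epsilon> \<subseteq> MC" by (auto simp: near_zero_def)
    fix \<Phi> assume "\<Phi> \<in> near_zero A \<epsilon>"
    then obtain \<delta> where \<delta>: "\<delta> < \<epsilon>" "\<And>x. x \<in> A \<Longrightarrow> \<Phi> x \<subseteq> ball 0 \<delta>"
      by (auto simp: near_zero_def)
    have "MC_entourage A ((\<epsilon> - \<delta>) / 2) `` {\<Phi>} \<subseteq> near_zero A \<epsilon>"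
    proof
      fix \<Psi> assume "\<Psi> \<in> MC_entourage A ((\<epsilon> - \<delta>) / 2) `` {\<Phi>}"
      then have \<Psi>: "\<Psi> \<in> MC" "\<And>x. x \<in> A \<Longrightarrow> \<Psi> x \<subseteq> (\<Union>y\<in>\<Phi> x. ball y ((\<epsilon> - \<delta>) / 2))"
        by (auto simp: MC_entourage_def)
      have "\<Psi> x \<subseteq> ball 0 ((\<epsilon> + \<delta>) / 2)" if "x \<in> A" for x
      proof
        fix z assume "z \<in> \<Psi> x"
        with \<Psi>(2)[OF \<open>x \<in> A\<close>] obtain y where "y \<in> \<Phi> x" "dist y z < (\<epsilon> - \<delta>) / 2"
          by auto
        moreover from this have "dist 0 y < \<delta>"
          using \<delta>(2)[OF \<open>x \<in> A\<close>] by auto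
        ultimately show "z \<in> ball 0 ((\<epsilon> + \<delta>) / 2)"
          using dist_triangle[of 0 z y] by (simp add: field_simps)
      qed
      moreover have "(\<epsilon> + \<delta>) / 2 < \<epsilon>" using \<delta>(1) by simp
      ultimately show "\<Psi> \<in> near_zero A \<epsilon>"
        using \<Psi>(1) unfolding near_zero_def by blast
    qed
    moreover have "(\<epsilon> - \<delta>) / 2 > 0" using \<delta>(1) by simp
    ultimately show "\<exists>C\<in>\<A>. \<exists>\<epsilon>'>0. MC_entourage C \<epsilon>' `` {\<Phi>} \<subseteq> near_zero A \<epsilon>"
      using A by blast
  qed
  moreover have "(\<lambda>_. {0}) \<in> near_zero A \<epsilon>"
    unfolding near_zero_def
    using MC_const[of 0] \<open>\<epsilon> > 0\<close> by (intro CollectI conjI exI[of _ "\<epsilon> / 2"]) auto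
  moreover have "(\<lambda>_. {\<epsilon>}) \<notin> near_zero A \<epsilon>"
  proof -
    have "A \<noteq> {}" using \<A> A unfolding closed_ideal_def by blast
    then show ?thesis using \<open>\<epsilon> > 0\<close> by (auto simp: near_zero_def)
  qed
  then have "near_zero A \<epsilon> \<noteq> topspace (MC_space \<A>)"
    using MC_const[of \<epsilon>] topspace_MC_space[OF \<A>] by blast
  ultimately show ?thesis
    unfolding point_nbhds_def proper_opens_def by blast
qed

section \<open>The cycle of inequalities\<close>

lemma set_nbhds_game_le_closed_discrete_game:
  fixes \<A> \<B> :: "'a::topological_space set set"
  assumes \<A>: "closed_ideal \<A>" and \<B>: "closed_ideal \<B>" and normal: "ideal_normal \<A>"
    and seq_compact: "\<forall>B\<in>\<B>. seq_compact B"
  shows "G1 (set_nbhds euclidean ` \<A>) (- ideal_covers \<B>)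
    \<le>\<^sub>I\<^sub>I G1 (proper_opens (MC_space \<A>)) (closed_discrete_sets (MC_space \<B>))"
proof -
  define inside where "inside U A \<Phi> \<longleftrightarrow>
    A \<in> \<A> \<and> \<Phi> \<in> MC \<and> (\<forall>\<Psi>\<in>MC. (\<forall>x\<in>A. \<Psi> x = \<Phi> x) \<longrightarrow> \<Psi> \<in> U)"
    for U A and \<Phi> :: "'a \<Rightarrow> real set"
  have "\<exists>A \<Phi>. inside U A \<Phi>"
    if U: "U \<in> proper_opens (MC_space \<A>)" for U
  proof -
    obtain \<Phi> where "\<Phi> \<in> U" using U by (auto simp: proper_opens_def)
    have "openin (MC_space \<A>) U"
      using U by (simp add: proper_opens_def)
    then have "U \<subseteq> MC" "\<exists>A\<in>\<A>. \<exists>\<epsilon>>0. MC_entourage A \<epsilon> `` {\<Phi>} \<subseteq> U"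
      using \<open>\<Phi> \<in> U\<close> by (simp_all add: openin_MC_space_entourage[OF \<A>])
    then obtain A \<epsilon> where "\<Phi> \<in> MC" "A \<in> \<A>" "\<epsilon> > 0" "MC_entourage A \<epsilon> `` {\<Phi>} \<subseteq> U"
      using \<open>\<Phi> \<in> U\<close> by blast
    then have "inside U A \<Phi>"
      using MC_entourage_agree[of \<Phi> _ \<epsilon> A] unfolding inside_def by (metis Image_singleton_iff subsetD)
    then show ?thesis by blast
  qed
  then obtain K \<Phi> where inside: "\<And>U. U \<in> proper_opens (MC_space \<A>) \<Longrightarrow> inside U (K U) (\<Phi> U)"
    by metis
  have K: "K U \<in> \<A>" and \<Phi>: "\<Phi> U \<in> MC"
    and agree: "\<And>\<Psi>. \<Psi> \<in> MC \<Longrightarrow> (\<And>x. x \<in> K U \<Longrightarrow> \<Psi> x = \<Phi> U x) \<Longrightarrow> \<Psi> \<in> U"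
    if "U \<in> proper_opens (MC_space \<A>)" for U
    using inside[OF that] by (simp_all add: inside_def)
  define reply where "reply n U G = (SOME \<Psi>. \<Psi> \<in> MC \<and> (\<forall>x\<in>K U. \<Psi> x = \<Phi> U x) \<and>
    (\<forall>x. x \<notin> G \<longrightarrow> \<Psi> x = {real n}))" for n U and G :: "'a set"
  have reply: "reply n U G \<in> MC \<and> (\<forall>x\<in>K U. reply n U G x = \<Phi> U x) \<and>
      (\<forall>x. x \<notin> G \<longrightarrow> reply n U G x = {real n})"
    if U: "U \<in> proper_opens (MC_space \<A>)" and G: "G \<in> set_nbhds euclidean (K U)" for n U G
  proof -
    have "open G" "K U \<subseteq> G"
      using G by (auto simp: set_nbhds_def proper_opens_def)
    from MC_modify_outside[OF \<Phi>[OF U] normal K[OF U] this, of "real n"]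
    have "\<exists>\<Psi>. \<Psi> \<in> MC \<and> (\<forall>x\<in>K U. \<Psi> x = \<Phi> U x) \<and> (\<forall>x. x \<notin> G \<longrightarrow> \<Psi> x = {real n})"
      unfolding Bex_def .
    from someI_ex[OF this] show ?thesis
      unfolding reply_def .
  qed
  show ?thesis
  proof (rule game_le_by_translation[where f = "\<lambda>n U. set_nbhds euclidean (K U)" and g = reply],
      goal_cases)
    case (1 n U)
    then show ?case using K by auto
  next
    case (2 n U G)
    then show ?case using reply[of U G n] agree[of U "reply n U G"] by auto
  next
    case (3 U G)
    have U: "U n \<in> proper_opens (MC_space \<A>)" and G: "G n \<in> set_nbhds euclidean (K (U n))" for n
      using 3 by auto
    define \<Psi> where "\<Psi> n = reply n (U n) (G n)" for n
    have \<Psi>_MC: "\<Psi> n \<in> MC" and \<Psi>_out: "\<And>x. x \<notin> G n \<Longrightarrow> \<Psi> n x = {real n}" for n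
      using reply[OF U G] unfolding \<Psi>_def by blast+
    have "range G \<subseteq> proper_opens euclidean"
      using G unfolding set_nbhds_def by blast
    with 3(3) obtain B where B: "B \<in> \<B>" "\<And>n. \<not> B \<subseteq> G n"
      by (auto simp: proper_opens_ideal_cover_iff[OF \<B>])
    have "range \<Psi> \<in> closed_discrete_sets (MC_space \<B>)"
    proof (rule locally_finite_closed_discrete[OF \<B>])
      show "range \<Psi> \<subseteq> MC" using \<Psi>_MC by blast
      fix \<Theta> :: "'a \<Rightarrow> real set" assume \<Theta>: "\<Theta> \<in> MC"
      from cusco_bounded_on_seq_compact[OF MC_cusco[OF \<Theta>] bspec[OF seq_compact B(1)]]
      obtain M where M: "\<And>x. x \<in> B \<Longrightarrow> \<Theta> x \<subseteq> ball 0 M" by metis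
      have "n \<le> nat \<lceil>M + 1\<rceil>" if near: "(\<Theta>, \<Psi> n) \<in> MC_entourage B 1" for n
      proof -
        obtain x where x: "x \<in> B" "x \<notin> G n" using B(2) by blast
        have "\<Psi> n x \<subseteq> (\<Union>y\<in>\<Theta> x. ball y 1)"
          using near x(1) by (simp add: MC_entourage_def)
        then obtain y where "y \<in> \<Theta> x" "dist y (real n) < 1"
          using \<Psi>_out[OF x(2)] by auto
        moreover from this have "\<bar>y\<bar> < M"
          using M[OF x(1)] by auto
        ultimately have "real n < M + 1" by (simp add: dist_real_def)
        then show ?thesis by linarith
      qed
      then have "MC_entourage B 1 `` {\<Theta>} \<inter> range \<Psi> \<subseteq> \<Psi> ` {..nat \<lceil>M + 1\<rceil>}" by auto
      then have "finite (MC_entourage B 1 `` {\<Theta>} \<inter> range \<Psi>)"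
        using finite_surj[OF finite_atMost] by blast
      then show "\<exists>E\<in>MC_uniformity \<B>. finite (E `` {\<Theta>} \<inter> range \<Psi>)"
        using MC_entourage_uniformity[OF B(1), of 1] by auto
    qed
    then show ?case by (simp add: \<Psi>_def)
  qed
qed

lemma closed_discrete_game_le_clustering_game:
  assumes \<A>: "closed_ideal \<A>" and \<B>: "closed_ideal \<B>"
  shows "G1 (proper_opens (MC_space \<A>)) (closed_discrete_sets (MC_space \<B>))
    \<le>\<^sub>I\<^sub>I G1 (proper_opens (MC_space \<A>)) (- clustering_sets (MC_space \<B>) (\<lambda>_. {0}))"
proof (rule game_le_by_translation[where f = "\<lambda>n U. U - {\<lambda>_. {0}}" and g = "\<lambda>n U \<Phi>. \<Phi>"], goal_cases)
  case (1 n U)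
  then show ?case
    using openin_remove_zero[OF \<A>, of U] by (simp add: proper_opens_def)
next
  case (2 n U \<Phi>)
  then show ?case by blast
next
  case (3 U \<Phi>)
  have "MC_space \<B> closure_of range \<Phi> = range \<Phi>"
    using 3(3) by (simp add: closed_discrete_sets_def closure_of_closedin)
  moreover have "(\<lambda>_. {0}) \<notin> range \<Phi>"
    using 3(2) by (metis DiffD2 rangeE singletonI)
  ultimately show ?case
    by (simp add: clustering_sets_def)
qed

lemma clustering_game_le_point_nbhds_game:
  "G1 (proper_opens Y) D \<le>\<^sub>I\<^sub>I G1 (point_nbhds Y y) D"
  by (rule game_le_by_translation[where f = "\<lambda>n U. U" and g = "\<lambda>n U \<Phi>. \<Phi>"])
    (auto simp: point_nbhds_def)

lemma point_nbhds_game_le_set_nbhds_game: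
  fixes \<A> \<B> :: "'a::t1_space set set"
  assumes \<A>: "closed_ideal \<A>" and \<B>: "closed_ideal \<B>"
  shows "G1 (point_nbhds (MC_space \<A>) (\<lambda>_. {0})) (- clustering_sets (MC_space \<B>) (\<lambda>_. {0}))
    \<le>\<^sub>I\<^sub>I G1 (set_nbhds euclidean ` \<A>) (- ideal_covers \<B>)"
proof -
  have "\<forall>N \<in> set_nbhds euclidean ` \<A>. \<exists>A. A \<in> \<A> \<and> N = set_nbhds euclidean A"
    by auto
  from bchoice[OF this] obtain K
    where K: "\<And>N. N \<in> set_nbhds euclidean ` \<A> \<Longrightarrow> K N \<in> \<A> \<and> N = set_nbhds euclidean (K N)"
    by blast
  have "\<exists>p. p \<notin> K N" if "N \<in> set_nbhds euclidean ` \<A>" for N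
    using K[OF that] \<A> unfolding closed_ideal_def by (metis UNIV_eq_I)
  then obtain p where p: "\<And>N. N \<in> set_nbhds euclidean ` \<A> \<Longrightarrow> p N \<notin> K N"
    by metis
  \<comment> \<open>The bounds tend to zero, so that an accumulation point is obtained from sets of arbitrarily late
    innings. The open set where the \<open>n\<close>-th map is small may be the whole space, which is not a legal reply;
    deleting a fixed point outside of One's set \<open>K N\<close> makes it proper.\<close>
  define small where "small n N \<Phi> = {x. \<Phi> x \<subseteq> ball 0 ((1/2)^n)} - {p N}"
    for n N and \<Phi> :: "'a \<Rightarrow> real set"
  show ?thesis
  proof (rule game_le_by_translation[where f = "\<lambda>n N. near_zero (K N) ((1/2)^n)" and g = small],
      goal_cases)
    case (1 n N)
    then show ?case
      using near_zero_point_nbhd[OF \<A>, of "K N" "(1/2)^n"] K by simp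
  next
    case (2 n N \<Phi>)
    then have N: "N \<in> set_nbhds euclidean ` \<A>" by simp
    from 2 obtain \<delta> where "\<Phi> \<in> MC" and \<delta>: "\<delta> < (1/2)^n" "\<And>x. x \<in> K N \<Longrightarrow> \<Phi> x \<subseteq> ball 0 \<delta>"
      by (auto simp: near_zero_def)
    have "open (small n N \<Phi>)"
      unfolding small_def using cusco_open[OF MC_cusco[OF \<open>\<Phi> \<in> MC\<close>]] by (intro open_Diff) auto
    moreover have "K N \<subseteq> small n N \<Phi>"
    proof
      fix x assume x: "x \<in> K N"
      have "ball 0 \<delta> \<subseteq> ball (0::real) ((1/2)^n)" using \<delta>(1) by (intro subset_ball) simp
      then show "x \<in> small n N \<Phi>"
        using \<delta>(2)[OF x] x p[OF N] unfolding small_def by blast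
    qed
    moreover have "K N \<noteq> {}"
      using \<A> K[OF N] unfolding closed_ideal_def by blast
    moreover have "small n N \<Phi> \<noteq> UNIV"
      unfolding small_def by blast
    ultimately have "small n N \<Phi> \<in> set_nbhds euclidean (K N)"
      by (auto simp: set_nbhds_def proper_opens_def)
    then show ?case using K[OF N] by blast
  next
    case (3 N \<Phi>)
    have \<Phi>: "\<Phi> n \<in> MC" for n
      using 3(2)[of n] by (simp add: near_zero_def)
    define G where "G n = small n (N n) (\<Phi> n)" for n
    have "range \<Phi> \<in> clustering_sets (MC_space \<B>) (\<lambda>_. {0})" if cover: "range G \<in> ideal_covers \<B>"
    proof -
      have large: "range G \<in> large_ideal_covers \<B>"
        using cover large_ideal_covers_eq[OF \<B>] by blast
      have "\<exists>n. \<Phi> n \<in> T" if T: "openin (MC_space \<B>) T" "(\<lambda>_. {0}) \<in> T" for T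
      proof -
        obtain B \<epsilon> where B: "B \<in> \<B>" "\<epsilon> > 0" "MC_entourage B \<epsilon> `` {\<lambda>_. {0}} \<subseteq> T"
          using T unfolding openin_MC_space_entourage[OF \<B>] by blast
        obtain m where m: "(1/2)^m < \<epsilon>"
          using real_arch_pow_inv[OF B(2), of "1/2"] by auto
        have "infinite {U \<in> range G. B \<subseteq> U}"
          using large B(1) by (simp add: large_ideal_covers_def)
        then have "\<not> {U \<in> range G. B \<subseteq> U} \<subseteq> G ` {..<m}"
          using finite_surj[OF finite_lessThan] by blast
        then obtain n where n: "B \<subseteq> G n" "n \<ge> m"
          by (auto simp: not_less) (metis image_eqI lessThan_iff linorder_not_less)
        have "(1/2)^n \<le> (1/2::real)^m"
          using n(2) by (intro power_decreasing) auto
        then have "ball 0 ((1/2)^n) \<subseteq> ball (0::real) \<epsilon>"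
          using m by (intro subset_ball) linarith
        then have small: "\<Phi> n x \<subseteq> ball 0 \<epsilon>" if "x \<in> B" for x
          using n(1) that unfolding G_def small_def by blast
        have "\<exists>y\<in>\<Phi> n x. \<bar>y\<bar> < \<epsilon>" if "x \<in> B" for x
          using small[OF that] cusco_nonempty[OF MC_cusco[OF \<Phi>[of n]], of x] by fastforce
        then have "(\<lambda>_. {0}, \<Phi> n) \<in> MC_entourage B \<epsilon>"
          using small \<Phi> MC_const[of 0] by (auto simp: MC_entourage_def)
        then show ?thesis using B(3) by blast
      qed
      then have "(\<lambda>_. {0}) \<in> MC_space \<B> closure_of range \<Phi>"
        unfolding in_closure_of topspace_MC_space[OF \<B>] using MC_const[of 0] by auto
      moreover have "range \<Phi> \<subseteq> MC"
        using \<Phi> by auto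
      ultimately show ?thesis
        by (simp add: clustering_sets_def topspace_MC_space[OF \<B>])
    qed
    then show ?case
      using 3(3) by (auto simp: G_def)
  qed
qed

theorem theorem35:
  fixes \<A> \<B> :: "'a::t2_space set set"
  assumes "closed_ideal \<A>" and "closed_ideal \<B>"
    and "ideal_normal \<A>"
    and "\<forall>B\<in>\<B>. seq_compact B"
  shows "(G1 (set_nbhds euclidean ` \<A>) (- large_ideal_covers \<B>)
           \<le>\<^sub>I\<^sub>I G1 (proper_opens (MC_space \<A>)) (closed_discrete_sets (MC_space \<B>)))
    \<and> (G1 (set_nbhds euclidean ` \<A>) (- ideal_covers \<B>)
           \<equiv>\<^sub>I\<^sub>I G1 (point_nbhds (MC_space \<A>) (\<lambda>_. {0})) (- clustering_sets (MC_space \<B>) (\<lambda>_. {0})))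
    \<and> (G1 (point_nbhds (MC_space \<A>) (\<lambda>_. {0})) (- clustering_sets (MC_space \<B>) (\<lambda>_. {0}))
           \<equiv>\<^sub>I\<^sub>I G1 (proper_opens (MC_space \<A>)) (- clustering_sets (MC_space \<B>) (\<lambda>_. {0})))
    \<and> (G1 (proper_opens (MC_space \<A>)) (- clustering_sets (MC_space \<B>) (\<lambda>_. {0}))
           \<equiv>\<^sub>I\<^sub>I G1 (proper_opens (MC_space \<A>)) (closed_discrete_sets (MC_space \<B>)))"
proof -
  have 1: "G1 (set_nbhds euclidean ` \<A>) (- ideal_covers \<B>)
      \<le>\<^sub>I\<^sub>I G1 (proper_opens (MC_space \<A>)) (closed_discrete_sets (MC_space \<B>))"
    using assms by (rule set_nbhds_game_le_closed_discrete_game)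
  have 2: "G1 (proper_opens (MC_space \<A>)) (closed_discrete_sets (MC_space \<B>))
      \<le>\<^sub>I\<^sub>I G1 (proper_opens (MC_space \<A>)) (- clustering_sets (MC_space \<B>) (\<lambda>_. {0}))"
    using assms(1,2) by (rule closed_discrete_game_le_clustering_game)
  have 3: "G1 (proper_opens (MC_space \<A>)) (- clustering_sets (MC_space \<B>) (\<lambda>_. {0}))
      \<le>\<^sub>I\<^sub>I G1 (point_nbhds (MC_space \<A>) (\<lambda>_. {0})) (- clustering_sets (MC_space \<B>) (\<lambda>_. {0}))"
    by (rule clustering_game_le_point_nbhds_game)
  have 4: "G1 (point_nbhds (MC_space \<A>) (\<lambda>_. {0})) (- clustering_sets (MC_space \<B>) (\<lambda>_. {0}))
      \<le>\<^sub>I\<^sub>I G1 (set_nbhds euclidean ` \<A>) (- ideal_covers \<B>)"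
    using assms(1,2) by (rule point_nbhds_game_le_set_nbhds_game)
  show ?thesis
    unfolding game_equiv_def large_ideal_covers_eq[OF assms(2)]
    using 1 2 3 4 game_le_trans[OF game_le_trans[OF 1 2] 3]
      game_le_trans[OF game_le_trans[OF 4 1] 2] game_le_trans[OF game_le_trans[OF 3 4] 1]
    by (intro conjI)
qed

end
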